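(* Let $L$ be an intermediate logic. The following are equivalent. (1) $L$ is well-connected. (2) $L$ is Hallden complete. (3) $L$ is the logic of a general intuitionistic frame over $\mathfrak{T}_2$. (4) $L$ is the logic of a general intuitionistic frame over $\mathfrak{L}_2$. (5) $L$ is the logic of a Heyting subalgebra of the Heyting algebra $\mathrm{Up}(\mathfrak{T}_2)$. (6) $L$ is the logic of a Heyting subalgebra of the Heyting algebra $\mathrm{Up}(\mathfrak{L}_2)$.
   Context: An intermediate logic is a set $L$ of propositional formulas (over a countably infinite set of letters), closed under Modus Ponens and uniform substitution, with $\mathbf{IPC}\subseteq L\subseteq\mathbf{CPC}$, where $\mathbf{IPC}$ and $\mathbf{CPC}$ are the intuitionistic and classical propositional calculi. The logic of a Heyting algebra $\mathfrak{H}$ is the set $L(\mathfrak{H})$ of formulas that evaluate to $1$ in $\mathfrak{H}$ under every assignment. A Heyting algebra is well-connected if $a\vee b=1$ implies $a=1$ or $b=1$. An intermediate logic $L$ is well-connected if $L=L(\mathfrak{H})$ for some well-connected Heyting algebra $\mathfrak{H}$. $L$ is Hallden complete if whenever $\varphi\vee\psi\in L$ and $\varphi,\psi$ have no common propositional letters, then $\varphi\in L$ or $\psi\in L$. For a partially ordered set $\mathfrak{F}=(W,\le)$, $\mathrm{Up}(\mathfrak{F})$ is the Heyting algebra of upsets of $\mathfrak{F}$. A general intuitionistic frame over $\mathfrak{F}$ is a triple $(W,\le,\mathcal{U})$ with $\mathcal{U}$ a Heyting subalgebra of $\mathrm{Up}(\mathfrak{F})$ (equivalently, $\mathcal{U}$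 is the set of those upsets that belong to $\mathcal{P}$, for some field of sets $\mathcal{P}$ over $W$ closed under taking downsets); its logic is $L(\mathcal{U})$. $T_2$ is the set of finite $\{0,1\}$-valued sequences (including the empty one), and $L_2$ is $T_2$ together with all infinite sequences $\omega\to\{0,1\}$. Both are ordered by $a\le b$ iff $a$ is an initial segment of $b$; $\mathfrak{T}_2=(T_2,\le)$ and $\mathfrak{L}_2=(L_2,\le)$. *)

theory Defs
  imports "HOL-Algebra.Lattice" "HOL-Library.Sublist"
begin

section \<open>Intermediate logics\<close>

datatype (letters: 'v) form =
    Letter 'v
  | Falsum  (\<open>\<^bold>\<bottom>\<close>)
  | Conj "'v form" "'v form"  (infixr \<open>\<^bold>\<and>\<close> 70)
  | Disj "'v form" "'v form"  (infixr \<open>\<^bold>\<or>\<close> 65)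
  | Impl "'v form" "'v form"  (infixr \<open>\<^bold>\<longrightarrow>\<close> 60)

primrec subst :: "('v \<Rightarrow> 'w form) \<Rightarrow> 'v form \<Rightarrow> 'w form" where
  "subst \<sigma> (Letter p) = \<sigma> p"
| "subst \<sigma> \<^bold>\<bottom> = \<^bold>\<bottom>"
| "subst \<sigma> (\<phi> \<^bold>\<and> \<psi>) = subst \<sigma> \<phi> \<^bold>\<and> subst \<sigma> \<psi>"
| "subst \<sigma> (\<phi> \<^bold>\<or> \<psi>) = subst \<sigma> \<phi> \<^bold>\<or> subst \<sigma> \<psi>"
| "subst \<sigma> (\<phi> \<^bold>\<longrightarrow> \<psi>) = subst \<sigma> \<phi> \<^bold>\<longrightarrow> subst \<sigma> \<psi>"

text \<open>The Hilbert calculus for intuitionistic logic, extended by the set \<open>Ax\<close> of additional axioms.\<close>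

inductive_set derivable :: "'v form set \<Rightarrow> 'v form set" for Ax :: "'v form set" where
  extra: "\<phi> \<in> Ax \<Longrightarrow> \<phi> \<in> derivable Ax"
| K: "\<phi> \<^bold>\<longrightarrow> \<psi> \<^bold>\<longrightarrow> \<phi> \<in> derivable Ax"
| S: "(\<phi> \<^bold>\<longrightarrow> \<psi> \<^bold>\<longrightarrow> \<chi>) \<^bold>\<longrightarrow> (\<phi> \<^bold>\<longrightarrow> \<psi>) \<^bold>\<longrightarrow> \<phi> \<^bold>\<longrightarrow> \<chi> \<in> derivable Ax"
| conjE1: "\<phi> \<^bold>\<and> \<psi> \<^bold>\<longrightarrow> \<phi> \<in> derivable Ax"
| conjE2: "\<phi> \<^bold>\<and> \<psi> \<^bold>\<longrightarrow> \<psi> \<in> derivable Ax"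
| conjI: "\<phi> \<^bold>\<longrightarrow> \<psi> \<^bold>\<longrightarrow> \<phi> \<^bold>\<and> \<psi> \<in> derivable Ax"
| disjI1: "\<phi> \<^bold>\<longrightarrow> \<phi> \<^bold>\<or> \<psi> \<in> derivable Ax"
| disjI2: "\<psi> \<^bold>\<longrightarrow> \<phi> \<^bold>\<or> \<psi> \<in> derivable Ax"
| disjE: "(\<phi> \<^bold>\<longrightarrow> \<chi>) \<^bold>\<longrightarrow> (\<psi> \<^bold>\<longrightarrow> \<chi>) \<^bold>\<longrightarrow> \<phi> \<^bold>\<or> \<psi> \<^bold>\<longrightarrow> \<chi> \<in> derivable Ax"
| exfalso: "\<^bold>\<bottom> \<^bold>\<longrightarrow> \<phi> \<in> derivable Ax"
| MP: "\<phi> \<^bold>\<longrightarrow> \<psi> \<in> derivable Ax \<Longrightarrow> \<phi> \<in> derivable Ax \<Longrightarrow> \<psi> \<in> derivable Ax"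

definition IPC :: "'v form set" where
  "IPC = derivable {}"

definition CPC :: "'v form set" where
  "CPC = derivable {\<phi> \<^bold>\<or> (\<phi> \<^bold>\<longrightarrow> \<^bold>\<bottom>) | \<phi>. True}"

definition intermediate_logic :: "'v form set \<Rightarrow> bool" where
  "intermediate_logic L \<longleftrightarrow>
     IPC \<subseteq> L \<and> L \<subseteq> CPC \<and>
     (\<forall>\<phi> \<psi>. (\<phi> \<^bold>\<longrightarrow> \<psi>) \<in> L \<longrightarrow> \<phi> \<in> L \<longrightarrow> \<psi> \<in> L) \<and>
     (\<forall>\<sigma>. \<forall>\<phi>\<in>L. subst \<sigma> \<phi> \<in> L)"

definition hallden_complete :: "'v form set \<Rightarrow> bool" where
  "hallden_complete L \<longleftrightarrow>
     (\<forall>\<phi> \<psi>. (\<phi> \<^bold>\<or> \<psi>) \<in> L \<longrightarrow> letters \<phi> \<inter> letters \<psi> = {} \<longrightarrow> \<phi> \<in> L \<or> \<psi> \<in> L)"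


section \<open>Heyting algebras\<close>

locale heyting_algebra = bounded_lattice H for H (structure) +
  assumes relative_pseudocomplement_exists:
    "\<lbrakk>a \<in> carrier H; b \<in> carrier H\<rbrakk> \<Longrightarrow> \<exists>c. greatest H c {x \<in> carrier H. a \<sqinter> x \<sqsubseteq> b}"

definition himp :: "'a gorder \<Rightarrow> 'a \<Rightarrow> 'a \<Rightarrow> 'a"  (infixr \<open>\<leadsto>\<index>\<close> 60) where
  "a \<leadsto>\<^bsub>H\<^esub> b = (THE c. greatest H c {x \<in> carrier H. a \<sqinter>\<^bsub>H\<^esub> x \<sqsubseteq>\<^bsub>H\<^esub> b})"

text \<open>The operations are those of \<open>H\<close>; the subalgebra itself, as a Heyting algebra, is
  \<open>H\<lparr>carrier := S\<rparr>\<close>.\<close>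

definition heyting_subalgebra :: "'a set \<Rightarrow> 'a gorder \<Rightarrow> bool" where
  "heyting_subalgebra S H \<longleftrightarrow>
     heyting_algebra H \<and> S \<subseteq> carrier H \<and> \<bottom>\<^bsub>H\<^esub> \<in> S \<and> \<top>\<^bsub>H\<^esub> \<in> S \<and>
     (\<forall>a\<in>S. \<forall>b\<in>S. a \<sqinter>\<^bsub>H\<^esub> b \<in> S \<and> a \<squnion>\<^bsub>H\<^esub> b \<in> S \<and> a \<leadsto>\<^bsub>H\<^esub> b \<in> S)"

primrec eval :: "'a gorder \<Rightarrow> ('v \<Rightarrow> 'a) \<Rightarrow> 'v form \<Rightarrow> 'a" where
  "eval H v (Letter p) = v p"
| "eval H v \<^bold>\<bottom> = \<bottom>\<^bsub>H\<^esub>"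
| "eval H v (\<phi> \<^bold>\<and> \<psi>) = eval H v \<phi> \<sqinter>\<^bsub>H\<^esub> eval H v \<psi>"
| "eval H v (\<phi> \<^bold>\<or> \<psi>) = eval H v \<phi> \<squnion>\<^bsub>H\<^esub> eval H v \<psi>"
| "eval H v (\<phi> \<^bold>\<longrightarrow> \<psi>) = eval H v \<phi> \<leadsto>\<^bsub>H\<^esub> eval H v \<psi>"

definition logic_of :: "'a gorder \<Rightarrow> 'v form set" where
  "logic_of H = {\<phi>. \<forall>v. range v \<subseteq> carrier H \<longrightarrow> eval H v \<phi> = \<top>\<^bsub>H\<^esub>}"

definition well_connected_algebra :: "'a gorder \<Rightarrow> bool" where
  "well_connected_algebra H \<longleftrightarrow>
     heyting_algebra H \<and>
     (\<forall>a\<in>carrier H. \<forall>b\<in>carrier H. a \<squnion>\<^bsub>H\<^esub> b = \<top>\<^bsub>H\<^esub> \<longrightarrow> a = \<top>\<^bsub>H\<^esub> \<or> b = \<top>\<^bsub>H\<^esub>)"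

text \<open>HOL cannot quantify over the type of the elements of an algebra inside a formula, so that
  type is a parameter.\<close>

definition well_connected_logic :: "'a itself \<Rightarrow> 'v form set \<Rightarrow> bool" where
  "well_connected_logic (_ :: 'a itself) L \<longleftrightarrow>
     (\<exists>H :: 'a gorder. well_connected_algebra H \<and> L = logic_of H)"


section \<open>Upsets and general intuitionistic frames\<close>

definition upset :: "'w gorder \<Rightarrow> 'w set \<Rightarrow> bool" where
  "upset F U \<longleftrightarrow>
     U \<subseteq> carrier F \<and> (\<forall>x\<in>U. \<forall>y\<in>carrier F. x \<sqsubseteq>\<^bsub>F\<^esub> y \<longrightarrow> y \<in> U)"

definition Up :: "'w gorder \<Rightarrow> 'w set gorder" where
  "Up F = \<lparr>carrier = {U. upset F U}, eq = (=), le = (\<subseteq>)\<rparr>"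

definition general_intuitionistic_frame :: "'w gorder \<Rightarrow> 'w set set \<Rightarrow> bool" where
  "general_intuitionistic_frame F \<U> \<longleftrightarrow> partial_order F \<and> heyting_subalgebra \<U> (Up F)"

definition frame_logic :: "'w gorder \<Rightarrow> 'w set set \<Rightarrow> 'v form set" where
  "frame_logic F \<U> = logic_of ((Up F)\<lparr>carrier := \<U>\<rparr>)"


section \<open>The binary tree, without and with its infinite branches\<close>

definition T2 :: "bool list gorder" where
  "T2 = \<lparr>carrier = UNIV, eq = (=), le = prefix\<rparr>"

datatype bseq = Fin "bool list" | Inf "nat \<Rightarrow> bool"

fun initial_segment :: "bseq \<Rightarrow> bseq \<Rightarrow> bool" where
  "initial_segment (Fin s) (Fin t) \<longleftrightarrow> prefix s t"
| "initial_segment (Fin s) (Inf f) \<longleftrightarrow> s = map f [0..<length s]"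
| "initial_segment (Inf f) (Fin t) \<longleftrightarrow> False"
| "initial_segment (Inf f) (Inf g) \<longleftrightarrow> f = g"

definition L2 :: "bseq gorder" where
  "L2 = \<lparr>carrier = UNIV, eq = (=), le = initial_segment\<rparr>"

section \<open>Basic facts\<close>

lemma partial_order_T2: "partial_order T2"
  by unfold_locales (auto simp: T2_def)

lemma initial_segment_antisym:
  "initial_segment x y \<Longrightarrow> initial_segment y x \<Longrightarrow> x = y"
  by (cases x; cases y) auto

lemma prefix_map_upt: "prefix s (map f [0..<n]) \<Longrightarrow> s = map f [0..<length s]"
  by (auto simp: prefix_def intro!: nth_equalityI) 
     (metis (no_types, lifting) add.left_neutral add_lessD1 diff_zero length_append length_map 
       length_upt nth_append nth_map nth_upt trans_less_add1)

lemma initial_segment_trans: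
  "initial_segment x y \<Longrightarrow> initial_segment y z \<Longrightarrow> initial_segment x z"
  by (cases x; cases y; cases z) (auto, metis prefix_map_upt)

lemma partial_order_L2: "partial_order L2"
proof -
  have "initial_segment x x" for x by (cases x) auto
  then show ?thesis
    by unfold_locales 
      (auto simp: L2_def intro: initial_segment_antisym initial_segment_trans)
qed

context
  fixes F :: "'w gorder"
begin

lemma Up_sel: "carrier (Up F) = {U. upset F U}" "A \<sqsubseteq>\<^bsub>Up F\<^esub> B \<longleftrightarrow> A \<subseteq> B"
  by (simp_all add: Up_def)

lemma partial_order_Up: "partial_order (Up F)"
  by unfold_locales (auto simp: Up_def)

interpretation Up: partial_order "Up F" by (rule partial_order_Up)

lemma greatest_Up_Int: 
  assumes "upset F A" "upset F B"
  shows "greatest (Up F) (A \<inter> B) (Lower (Up F) {A, B})"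
  using assms unfolding greatest_def Lower_def by (auto simp: Up_def upset_def)

lemma least_Up_Un: 
  assumes "upset F A" "upset F B"
  shows "least (Up F) (A \<union> B) (Upper (Up F) {A, B})"
  using assms unfolding least_def Upper_def by (auto simp: Up_def upset_def)

lemma meet_Up: "upset F A \<Longrightarrow> upset F B \<Longrightarrow> A \<sqinter>\<^bsub>Up F\<^esub> B = A \<inter> B"
  unfolding meet_def inf_def
  using greatest_Up_Int Up.greatest_unique by (intro some_equality) blast+

lemma join_Up: "upset F A \<Longrightarrow> upset F B \<Longrightarrow> A \<squnion>\<^bsub>Up F\<^esub> B = A \<union> B"
  unfolding join_def sup_def
  using least_Up_Un Up.least_unique by (intro some_equality) blast+

lemma greatest_Up: "greatest (Up F) (carrier F) (carrier (Up F))"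
  by (auto simp: greatest_def Up_def upset_def)

lemma least_Up: "least (Up F) {} (carrier (Up F))"
  by (auto simp: least_def Up_def upset_def)

lemma top_Up: "\<top>\<^bsub>Up F\<^esub> = carrier F"
  unfolding top_def
  using greatest_Up Up.greatest_unique by (intro some_equality) blast+

lemma bottom_Up: "\<bottom>\<^bsub>Up F\<^esub> = {}"
  unfolding bottom_def
  using least_Up Up.least_unique by (intro some_equality) blast+

lemma greatest_Up_himp:
  assumes "partial_order F" "upset F A" "upset F B"
  shows "greatest (Up F) {x \<in> carrier F. \<forall>y\<in>carrier F. x \<sqsubseteq>\<^bsub>F\<^esub> y \<longrightarrow> y \<in> A \<longrightarrow> y \<in> B}
           {X \<in> carrier (Up F). A \<sqinter>\<^bsub>Up F\<^esub> X \<sqsubseteq>\<^bsub>Up F\<^esub> B}"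
proof -
  interpret F: partial_order F by fact
  define I where "I = {x \<in> carrier F. \<forall>y\<in>carrier F. x \<sqsubseteq>\<^bsub>F\<^esub> y \<longrightarrow> y \<in> A \<longrightarrow> y \<in> B}"
  have "upset F I" unfolding upset_def I_def by (auto intro: F.le_trans)
  moreover have "A \<inter> I \<subseteq> B" by (auto simp: I_def)
  moreover have "X \<subseteq> I" if "upset F X" "A \<inter> X \<subseteq> B" for X
    using that unfolding upset_def I_def by blast
  moreover have "{X \<in> carrier (Up F). A \<sqinter>\<^bsub>Up F\<^esub> X \<sqsubseteq>\<^bsub>Up F\<^esub> B} = {X. upset F X \<and> A \<inter> X \<subseteq> B}"
    using assms(2) by (auto simp: Up_sel meet_Up)
  ultimately have "greatest (Up F) I {X \<in> carrier (Up F). A \<sqinter>\<^bsub>Up F\<^esub> X \<sqsubseteq>\<^bsub>Up F\<^esub> B}"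
    unfolding greatest_def by (simp add: Up_sel Collect_mono)
  then show ?thesis by (simp add: I_def)
qed

lemma himp_Up:
  assumes "partial_order F" "upset F A" "upset F B"
  shows "A \<leadsto>\<^bsub>Up F\<^esub> B = {x \<in> carrier F. \<forall>y\<in>carrier F. x \<sqsubseteq>\<^bsub>F\<^esub> y \<longrightarrow> y \<in> A \<longrightarrow> y \<in> B}"
  unfolding himp_def
  by (rule the_equality, rule greatest_Up_himp[OF assms])
     (rule Up.greatest_unique[OF _ greatest_Up_himp[OF assms]])

lemma heyting_algebra_Up:
  assumes "partial_order F"
  shows "heyting_algebra (Up F)"
proof unfold_locales
  fix A B assume "A \<in> carrier (Up F)" "B \<in> carrier (Up F)"
  then have AB: "upset F A" "upset F B" by (auto simp: Up_def)
  show "\<exists>s. least (Up F) s (Upper (Up F) {A, B})" using least_Up_Un[OF AB] by blast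
  show "\<exists>s. greatest (Up F) s (Lower (Up F) {A, B})" using greatest_Up_Int[OF AB] by blast
  show "\<exists>C. greatest (Up F) C {X \<in> carrier (Up F). A \<sqinter>\<^bsub>Up F\<^esub> X \<sqsubseteq>\<^bsub>Up F\<^esub> B}"
    using greatest_Up_himp[OF assms AB] by blast
qed (use greatest_Up least_Up in blast)+

end

context
  fixes H :: "'a gorder" and S :: "'a set"
  assumes sub: "heyting_subalgebra S H"
begin

interpretation H: heyting_algebra H
  using sub by (simp add: heyting_subalgebra_def)

private abbreviation (input) "H' \<equiv> H\<lparr>carrier := S\<rparr>"

private lemma S: "S \<subseteq> carrier H" "\<bottom>\<^bsub>H\<^esub> \<in> S" "\<top>\<^bsub>H\<^esub> \<in> S"
  "a \<in> S \<Longrightarrow> b \<in> S \<Longrightarrow> a \<sqinter>\<^bsub>H\<^esub> b \<in> S" "a \<in> S \<Longrightarrow> b \<in> S \<Longrightarrow> a \<squnion>\<^bsub>H\<^esub> b \<in> S"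
  "a \<in> S \<Longrightarrow> b \<in> S \<Longrightarrow> a \<leadsto>\<^bsub>H\<^esub> b \<in> S" "x \<in> S \<Longrightarrow> x \<in> carrier H"
  using sub by (auto simp: heyting_subalgebra_def)

lemma partial_order_subalgebra: "partial_order H'"
  by unfold_locales
    (use S(1) H.eq_is_equal H.le_antisym in \<open>auto intro: H.le_trans dest: subsetD\<close>)

interpretation H': partial_order H' by (rule partial_order_subalgebra)

private lemma glb: "a \<in> S \<Longrightarrow> b \<in> S \<Longrightarrow> greatest H' (a \<sqinter>\<^bsub>H\<^esub> b) (Lower H' {a, b})"
  using S H.meet_left H.meet_right H.meet_le unfolding greatest_def Lower_def by auto

private lemma lub: "a \<in> S \<Longrightarrow> b \<in> S \<Longrightarrow> least H' (a \<squnion>\<^bsub>H\<^esub> b) (Upper H' {a, b})"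
  using S H.join_left H.join_right H.join_le unfolding least_def Upper_def by auto

lemma meet_subalgebra: "a \<in> S \<Longrightarrow> b \<in> S \<Longrightarrow> a \<sqinter>\<^bsub>H'\<^esub> b = a \<sqinter>\<^bsub>H\<^esub> b"
  unfolding meet_def[of H'] inf_def using glb H'.greatest_unique by (intro some_equality) blast+

lemma join_subalgebra: "a \<in> S \<Longrightarrow> b \<in> S \<Longrightarrow> a \<squnion>\<^bsub>H'\<^esub> b = a \<squnion>\<^bsub>H\<^esub> b"
  unfolding join_def[of H'] sup_def using lub H'.least_unique by (intro some_equality) blast+

private lemma greatest_sub: "greatest H' \<top>\<^bsub>H\<^esub> (carrier H')"
  using S H.top_higher unfolding greatest_def by auto

private lemma least_sub: "least H' \<bottom>\<^bsub>H\<^esub> (carrier H')"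
  using S H.bottom_lower unfolding least_def by auto

lemma top_subalgebra: "\<top>\<^bsub>H'\<^esub> = \<top>\<^bsub>H\<^esub>"
  unfolding top_def[of H'] using greatest_sub H'.greatest_unique by (intro some_equality) blast+

lemma bottom_subalgebra: "\<bottom>\<^bsub>H'\<^esub> = \<bottom>\<^bsub>H\<^esub>"
  unfolding bottom_def[of H'] using least_sub H'.least_unique by (intro some_equality) blast+

private lemma greatest_himp:
  assumes "a \<in> S" "b \<in> S"
  shows "greatest H' (a \<leadsto>\<^bsub>H\<^esub> b) {x \<in> carrier H'. a \<sqinter>\<^bsub>H'\<^esub> x \<sqsubseteq>\<^bsub>H'\<^esub> b}"
proof -
  have "\<exists>!c. greatest H c {x \<in> carrier H. a \<sqinter>\<^bsub>H\<^esub> x \<sqsubseteq>\<^bsub>H\<^esub> b}"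
    using H.relative_pseudocomplement_exists H.greatest_unique S(7) assms by blast
  then have "greatest H (a \<leadsto>\<^bsub>H\<^esub> b) {x \<in> carrier H. a \<sqinter>\<^bsub>H\<^esub> x \<sqsubseteq>\<^bsub>H\<^esub> b}"
    unfolding himp_def by (rule theI')
  then show ?thesis
    using S meet_subalgebra assms unfolding greatest_def by auto
qed

lemma himp_subalgebra:
  assumes "a \<in> S" "b \<in> S" 
  shows "a \<leadsto>\<^bsub>H'\<^esub> b = a \<leadsto>\<^bsub>H\<^esub> b"
  unfolding himp_def[of H'] 
  using greatest_himp[OF assms] H'.greatest_unique by (intro the_equality) blast+

lemma heyting_algebra_subalgebra: "heyting_algebra H'"
proof unfold_locales
  fix a b assume "a \<in> carrier H'" "b \<in> carrier H'"
  then have ab: "a \<in> S" "b \<in> S" by auto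
  show "\<exists>s. least H' s (Upper H' {a, b})" using lub[OF ab] by blast
  show "\<exists>s. greatest H' s (Lower H' {a, b})" using glb[OF ab] by blast
  show "\<exists>c. greatest H' c {x \<in> carrier H'. a \<sqinter>\<^bsub>H'\<^esub> x \<sqsubseteq>\<^bsub>H'\<^esub> b}"
    using greatest_himp[OF ab] by blast
qed (use greatest_sub least_sub in blast)+

end

end

theory Submission
  imports Defs "HOL-Library.Countable"
begin

text \<open>
  The bridge between all the conditions is a single prime theory \<open>\<Gamma>\<close>, that is, a consistent,
  deductively closed set of formulas with the disjunction property, such that \<open>L\<close> consists of the
  formulas all of whose substitution instances lie in \<open>\<Gamma>\<close>. If \<open>L\<close> is Hallden complete, such a \<open>\<Gamma>\<close>
  exists (\<open>hallden_complete_prime_theory\<close>): rename the letters of the non-theorems of \<open>L\<close> apart; by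
  Hallden completeness no finite disjunction of the renamed formulas is in \<open>L\<close>, so Zorn's lemma
  extends \<open>L\<close> to a prime theory that omits all of them.

  The Lindenbaum algebra of \<open>\<Gamma>\<close> is then well-connected because \<open>\<Gamma>\<close> is prime, and its logic is \<open>L\<close>
  (\<open>lindenbaum_algebra.logic_of_eq\<close>). It is countable, so it can be coded in any infinite type.

  For the trees, the Lindenbaum algebra is represented by upsets, as in a canonical Kripke model.
  Attach to each node a prime theory, increasing along the order and with \<open>\<Gamma>\<close> at the root, such that
  every implication missing from the theory of a node is refuted by the theory of a node above it.
  Mapping a formula to the set of nodes whose theory contains it then embeds the Lindenbaum algebra
  of \<open>\<Gamma>\<close> in the algebra of all upsets (locale \<open>labelled_frame\<close>). On the binary tree, a step to the
  left child copies the theory, and the step to the right child from a node of depth \<open>n\<close> refutes the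
  \<open>n\<close>th implication of a list in which each implication recurs infinitely often. Hence every
  implication is refuted after enough steps to the left, if it has to be. An infinite branch is a
  maximal point of the larger tree, so its theory must treat implication classically; a maximal
  consistent extension of the union of the theories along the branch does.

  Conversely, in a well-connected algebra two valuations that refute formulas without common letters
  merge to one that refutes the disjunction, and every algebra of upsets of a rooted order is
  well-connected, because an upset that contains the root is everything.
\<close>

section \<open>Deductively closed theories\<close>

lemmas derivable_axioms =
  derivable.K derivable.S derivable.conjE1 derivable.conjE2 derivable.conjI
  derivable.disjI1 derivable.disjI2 derivable.disjE derivable.exfalso

lemma derivable_mono: "\<Gamma> \<subseteq> \<Delta> \<Longrightarrow> derivable \<Gamma> \<subseteq> derivable \<Delta>"
proof
  fix \<phi> assume "\<Gamma> \<subseteq> \<Delta>" "\<phi> \<in> derivable \<Gamma>"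
  from this(2,1) show "\<phi> \<in> derivable \<Delta>"
    by induction (blast intro: derivable_axioms derivable.extra, (rule derivable_axioms)+,
        rule derivable.MP)
qed

lemma derivable_weaken: "\<psi> \<in> derivable \<Gamma> \<Longrightarrow> \<phi> \<^bold>\<longrightarrow> \<psi> \<in> derivable \<Gamma>"
  by (rule derivable.MP[OF derivable.K])

lemma derivable_identity: "\<phi> \<^bold>\<longrightarrow> \<phi> \<in> derivable \<Gamma>"
  by (rule derivable.MP[OF derivable.MP[OF derivable.S derivable.K[of _ "\<phi> \<^bold>\<longrightarrow> \<phi>"]] derivable.K])

lemma deduction_theorem:
  assumes "\<psi> \<in> derivable (insert \<phi> \<Gamma>)"
  shows "\<phi> \<^bold>\<longrightarrow> \<psi> \<in> derivable \<Gamma>"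
  using assms
proof induction
  case (extra \<psi>)
  then show ?case
    using derivable_identity derivable_weaken derivable.extra by blast
next
  case (MP \<psi> \<chi>)
  show ?case
    by (rule derivable.MP[OF derivable.MP[OF derivable.S MP.IH(1)] MP.IH(2)])
qed (rule derivable_weaken, rule derivable_axioms)+

lemma derivable_idem: "derivable (derivable \<Gamma>) \<subseteq> derivable \<Gamma>"
proof
  fix \<phi> assume "\<phi> \<in> derivable (derivable \<Gamma>)"
  then show "\<phi> \<in> derivable \<Gamma>"
  proof induction
    case (MP \<phi> \<psi>)
    from MP.IH show ?case by (rule derivable.MP)
  qed (assumption | rule derivable_axioms)+
qed

locale deductive_theory =
  fixes \<Gamma> :: "'v form set"
  assumes closed: "derivable \<Gamma> \<subseteq> \<Gamma>"
begin

lemma derivable_iff: "\<phi> \<in> derivable \<Gamma> \<longleftrightarrow> \<phi> \<in> \<Gamma>"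
  using closed derivable.extra by blast

lemma impl_iff: "\<phi> \<^bold>\<longrightarrow> \<psi> \<in> \<Gamma> \<longleftrightarrow> \<psi> \<in> derivable (insert \<phi> \<Gamma>)"
proof
  assume "\<phi> \<^bold>\<longrightarrow> \<psi> \<in> \<Gamma>"
  then show "\<psi> \<in> derivable (insert \<phi> \<Gamma>)"
    by (intro derivable.MP[of \<phi> \<psi>] derivable.extra) simp_all
next
  assume "\<psi> \<in> derivable (insert \<phi> \<Gamma>)"
  then show "\<phi> \<^bold>\<longrightarrow> \<psi> \<in> \<Gamma>"
    using deduction_theorem derivable_iff by blast
qed

lemma mp: "\<phi> \<^bold>\<longrightarrow> \<psi> \<in> \<Gamma> \<Longrightarrow> \<phi> \<in> \<Gamma> \<Longrightarrow> \<psi> \<in> \<Gamma>"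
  using derivable.MP derivable_iff by blast

lemma axioms:
  "\<phi> \<^bold>\<longrightarrow> \<phi> \<in> \<Gamma>" "\<phi> \<^bold>\<and> \<psi> \<^bold>\<longrightarrow> \<phi> \<in> \<Gamma>" "\<phi> \<^bold>\<and> \<psi> \<^bold>\<longrightarrow> \<psi> \<in> \<Gamma>"
  "\<phi> \<^bold>\<longrightarrow> \<psi> \<^bold>\<longrightarrow> \<phi> \<^bold>\<and> \<psi> \<in> \<Gamma>" "\<phi> \<^bold>\<longrightarrow> \<phi> \<^bold>\<or> \<psi> \<in> \<Gamma>" "\<psi> \<^bold>\<longrightarrow> \<phi> \<^bold>\<or> \<psi> \<in> \<Gamma>"
  "(\<phi> \<^bold>\<longrightarrow> \<chi>) \<^bold>\<longrightarrow> (\<psi> \<^bold>\<longrightarrow> \<chi>) \<^bold>\<longrightarrow> \<phi> \<^bold>\<or> \<psi> \<^bold>\<longrightarrow> \<chi> \<in> \<Gamma>" "\<^bold>\<bottom> \<^bold>\<longrightarrow> \<phi> \<in> \<Gamma>"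
  by (rule subsetD[OF closed], rule derivable_identity derivable_axioms)+

lemma impl_trans:
  assumes "\<phi> \<^bold>\<longrightarrow> \<psi> \<in> \<Gamma>" "\<psi> \<^bold>\<longrightarrow> \<chi> \<in> \<Gamma>"
  shows "\<phi> \<^bold>\<longrightarrow> \<chi> \<in> \<Gamma>"
proof -
  have "\<psi> \<^bold>\<longrightarrow> \<chi> \<in> derivable (insert \<phi> \<Gamma>)"
    using assms(2) by (blast intro: derivable.extra)
  then show ?thesis using assms(1) unfolding impl_iff by (rule derivable.MP)
qed

lemma weaken: "\<psi> \<in> \<Gamma> \<Longrightarrow> \<phi> \<^bold>\<longrightarrow> \<psi> \<in> \<Gamma>"
  using derivable_weaken derivable_iff by blast

lemma impl_conj:
  assumes "\<phi> \<^bold>\<longrightarrow> \<psi> \<in> \<Gamma>" "\<phi> \<^bold>\<longrightarrow> \<chi> \<in> \<Gamma>"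
  shows "\<phi> \<^bold>\<longrightarrow> \<psi> \<^bold>\<and> \<chi> \<in> \<Gamma>"
  using assms unfolding impl_iff by (intro derivable.MP[OF derivable.MP[OF derivable.conjI]])

lemma conj_iff: "\<phi> \<^bold>\<and> \<psi> \<in> \<Gamma> \<longleftrightarrow> \<phi> \<in> \<Gamma> \<and> \<psi> \<in> \<Gamma>"
  using mp[OF axioms(2)] mp[OF axioms(3)] mp[OF mp[OF axioms(4)]] by blast

lemma disj_impl: "\<phi> \<^bold>\<longrightarrow> \<chi> \<in> \<Gamma> \<Longrightarrow> \<psi> \<^bold>\<longrightarrow> \<chi> \<in> \<Gamma> \<Longrightarrow> \<phi> \<^bold>\<or> \<psi> \<^bold>\<longrightarrow> \<chi> \<in> \<Gamma>"
  by (rule mp[OF mp[OF axioms(7)]])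

lemma residuation: "\<phi> \<^bold>\<and> \<chi> \<^bold>\<longrightarrow> \<psi> \<in> \<Gamma> \<longleftrightarrow> \<chi> \<^bold>\<longrightarrow> \<phi> \<^bold>\<longrightarrow> \<psi> \<in> \<Gamma>"
proof
  assume *: "\<phi> \<^bold>\<and> \<chi> \<^bold>\<longrightarrow> \<psi> \<in> \<Gamma>"
  let ?D = "derivable (insert \<phi> (insert \<chi> \<Gamma>))"
  have "\<phi> \<^bold>\<and> \<chi> \<in> ?D"
    by (rule derivable.MP[OF derivable.MP[OF derivable.conjI]]) (simp_all add: derivable.extra)
  moreover have "\<phi> \<^bold>\<and> \<chi> \<^bold>\<longrightarrow> \<psi> \<in> ?D"
    using * by (simp add: derivable.extra)
  ultimately have "\<psi> \<in> ?D" by (rule derivable.MP[rotated])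
  then show "\<chi> \<^bold>\<longrightarrow> \<phi> \<^bold>\<longrightarrow> \<psi> \<in> \<Gamma>"
    unfolding impl_iff[of \<chi>] by (rule deduction_theorem)
next
  assume *: "\<chi> \<^bold>\<longrightarrow> \<phi> \<^bold>\<longrightarrow> \<psi> \<in> \<Gamma>"
  let ?D = "derivable (insert (\<phi> \<^bold>\<and> \<chi>) \<Gamma>)"
  have "\<phi> \<^bold>\<and> \<chi> \<in> ?D" by (simp add: derivable.extra)
  then have "\<phi> \<in> ?D" "\<chi> \<in> ?D"
    using derivable.MP[OF derivable.conjE1] derivable.MP[OF derivable.conjE2] by blast+
  moreover have "\<chi> \<^bold>\<longrightarrow> \<phi> \<^bold>\<longrightarrow> \<psi> \<in> ?D"
    using * by (simp add: derivable.extra)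
  ultimately show "\<phi> \<^bold>\<and> \<chi> \<^bold>\<longrightarrow> \<psi> \<in> \<Gamma>"
    unfolding impl_iff by (blast intro: derivable.MP[of \<chi>] derivable.MP[of \<phi>])
qed

end

lemma deductive_theory_derivable: "deductive_theory (derivable \<Gamma>)"
  by unfold_locales (rule derivable_idem)

locale prime_theory = deductive_theory +
  assumes consistent: "\<^bold>\<bottom> \<notin> \<Gamma>"
    and prime: "\<phi> \<^bold>\<or> \<psi> \<in> \<Gamma> \<Longrightarrow> \<phi> \<in> \<Gamma> \<or> \<psi> \<in> \<Gamma>"
begin

lemma disj_iff: "\<phi> \<^bold>\<or> \<psi> \<in> \<Gamma> \<longleftrightarrow> \<phi> \<in> \<Gamma> \<or> \<psi> \<in> \<Gamma>"
  using prime mp[OF axioms(5)] mp[OF axioms(6)] by blast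

end

lemma deductive_theory_Union_chain:
  assumes chain: "\<And>S T. S \<in> C \<Longrightarrow> T \<in> C \<Longrightarrow> S \<subseteq> T \<or> T \<subseteq> S"
    and theories: "\<And>T. T \<in> C \<Longrightarrow> deductive_theory T"
    and "C \<noteq> {}"
  shows "deductive_theory (\<Union>C)"
proof
  show "derivable (\<Union>C) \<subseteq> \<Union>C"
  proof
    fix \<phi> assume "\<phi> \<in> derivable (\<Union>C)"
    obtain T\<^sub>0 where T\<^sub>0: "T\<^sub>0 \<in> C" using \<open>C \<noteq> {}\<close> by blast
    from \<open>\<phi> \<in> derivable (\<Union>C)\<close> have "\<exists>T\<in>C. \<phi> \<in> derivable T"
    proof induction
      case (extra \<phi>)
      then show ?case using derivable.extra by blast
    next
      case (MP \<phi> \<psi>)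
      then obtain S T where ST: "S \<in> C" "T \<in> C" "\<phi> \<^bold>\<longrightarrow> \<psi> \<in> derivable S" "\<phi> \<in> derivable T"
        by blast
      then have "\<psi> \<in> derivable S \<or> \<psi> \<in> derivable T"
        using chain[OF ST(1,2)] derivable_mono derivable.MP by blast
      then show ?case using ST by blast
    qed (rule bexI[OF _ T\<^sub>0], rule derivable_axioms)+
    then show "\<phi> \<in> \<Union>C"
      using theories by (auto simp: deductive_theory.derivable_iff)
  qed
qed

text \<open>For \<open>\<Delta> = {\<^bold>\<bottom>}\<close> the last property says that \<open>M\<close> decides every formula; for directed \<open>\<Delta>\<close> it yields
  primeness.\<close>

lemma maximal_theory_avoiding:
  assumes "deductive_theory \<Gamma>" and "\<Gamma> \<inter> \<Delta> = {}"
  obtains M where "deductive_theory M" "\<Gamma> \<subseteq> M" "M \<inter> \<Delta> = {}"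
    "\<And>\<phi>. \<phi> \<notin> M \<Longrightarrow> \<exists>\<delta>\<in>\<Delta>. \<phi> \<^bold>\<longrightarrow> \<delta> \<in> M"
proof -
  define \<A> where "\<A> = {T. deductive_theory T \<and> \<Gamma> \<subseteq> T \<and> T \<inter> \<Delta> = {}}"
  have "\<exists>M\<in>\<A>. \<forall>T\<in>\<A>. M \<subseteq> T \<longrightarrow> T = M"
  proof (rule subset_Zorn_nonempty)
    show "\<A> \<noteq> {}" using assms by (auto simp: \<A>_def)
  next
    fix C assume C: "C \<noteq> {}" "subset.chain \<A> C"
    then have "deductive_theory (\<Union>C)"
      by (intro deductive_theory_Union_chain) (auto simp: subset_chain_def \<A>_def)
    then show "\<Union>C \<in> \<A>"
      using C by (fastforce simp: subset_chain_def \<A>_def)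
  qed
  then obtain M where M: "M \<in> \<A>" and max: "\<And>T. T \<in> \<A> \<Longrightarrow> M \<subseteq> T \<Longrightarrow> T = M"
    by blast
  interpret deductive_theory M using M by (simp add: \<A>_def)
  have "\<exists>\<delta>\<in>\<Delta>. \<phi> \<^bold>\<longrightarrow> \<delta> \<in> M" if "\<phi> \<notin> M" for \<phi>
  proof (rule ccontr)
    assume no: "\<not> ?thesis"
    let ?T = "derivable (insert \<phi> M)"
    have "deductive_theory ?T" by (rule deductive_theory_derivable)
    moreover have "insert \<phi> M \<subseteq> ?T" using derivable.extra by blast
    moreover have "?T \<inter> \<Delta> = {}" using no by (auto simp: impl_iff)
    ultimately have "?T \<in> \<A>" using M by (auto simp: \<A>_def)
    then show False using max \<open>insert \<phi> M \<subseteq> ?T\<close> that by blast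
  qed
  then show thesis using that M unfolding \<A>_def by blast
qed

text \<open>Directedness makes a maximal theory prime: if neither disjunct is in it, then each disjunct implies
  an element of \<open>\<Delta>\<close>, and a common upper bound of these two elements is implied by the disjunction.\<close>

lemma prime_theory_avoiding:
  assumes "deductive_theory \<Gamma>" and "\<Gamma> \<inter> \<Delta> = {}" and "\<Delta> \<noteq> {}"
    and directed: "\<And>\<delta> \<epsilon>. \<delta> \<in> \<Delta> \<Longrightarrow> \<epsilon> \<in> \<Delta> \<Longrightarrow> \<exists>\<zeta>\<in>\<Delta>. \<delta> \<^bold>\<longrightarrow> \<zeta> \<in> \<Gamma> \<and> \<epsilon> \<^bold>\<longrightarrow> \<zeta> \<in> \<Gamma>"
  obtains P where "prime_theory P" "\<Gamma> \<subseteq> P" "P \<inter> \<Delta> = {}"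
proof -
  obtain P where P: "deductive_theory P" "\<Gamma> \<subseteq> P" "P \<inter> \<Delta> = {}"
    and max: "\<And>\<phi>. \<phi> \<notin> P \<Longrightarrow> \<exists>\<delta>\<in>\<Delta>. \<phi> \<^bold>\<longrightarrow> \<delta> \<in> P"
    using maximal_theory_avoiding[OF assms(1,2)] by metis
  interpret deductive_theory P by fact
  have "prime_theory P"
  proof
    show "\<^bold>\<bottom> \<notin> P" using P(3) \<open>\<Delta> \<noteq> {}\<close> mp[OF axioms(8)] by blast
  next
    fix \<phi> \<psi> assume disj: "\<phi> \<^bold>\<or> \<psi> \<in> P"
    show "\<phi> \<in> P \<or> \<psi> \<in> P"
    proof (rule ccontr)
      assume "\<not> ?thesis"
      then obtain \<delta> \<epsilon> where "\<delta> \<in> \<Delta>" "\<epsilon> \<in> \<Delta>" and *: "\<phi> \<^bold>\<longrightarrow> \<delta> \<in> P" "\<psi> \<^bold>\<longrightarrow> \<epsilon> \<in> P"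
        using max by metis
      then obtain \<zeta> where "\<zeta> \<in> \<Delta>" "\<delta> \<^bold>\<longrightarrow> \<zeta> \<in> P" "\<epsilon> \<^bold>\<longrightarrow> \<zeta> \<in> P"
        using directed P(2) by blast
      then have "\<zeta> \<in> P"
        using mp[OF disj_impl[OF impl_trans[OF *(1)] impl_trans[OF *(2)]] disj] by blast
      then show False using \<open>\<zeta> \<in> \<Delta>\<close> P(3) by blast
    qed
  qed
  then show thesis using that P by blast
qed

text \<open>This supplies the labels that witness the failure of an implication.\<close>

lemma (in deductive_theory) prime_extension_refuting_impl:
  assumes "\<phi> \<^bold>\<longrightarrow> \<psi> \<notin> \<Gamma>"
  obtains P where "prime_theory P" "\<Gamma> \<subseteq> P" "\<phi> \<in> P" "\<psi> \<notin> P"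
proof -
  have "derivable (insert \<phi> \<Gamma>) \<inter> {\<psi>} = {}"
    using assms by (simp add: impl_iff)
  then obtain P where P: "prime_theory P" "derivable (insert \<phi> \<Gamma>) \<subseteq> P" "P \<inter> {\<psi>} = {}"
    by (rule prime_theory_avoiding[OF deductive_theory_derivable])
      (auto simp: derivable_identity)
  then show thesis using that[OF P(1)] derivable.extra by blast
qed

section \<open>Algebras of formulas\<close>

text \<open>The quotient of the formulas by provable equivalence in \<open>\<Gamma>\<close>, up to isomorphism: \<open>V\<close> is any map onto
  an order that pulls the order back to provable implication. Keeping the carrier abstract lets the same
  facts serve for codes in an arbitrary infinite type and for algebras of upsets.\<close>

locale lindenbaum_algebra =
  partial_order H + deductive_theory \<Gamma>
  for H :: "'a gorder" (structure) and \<Gamma> :: "'v form set" +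
  fixes V :: "'v form \<Rightarrow> 'a"
  assumes carrier: "carrier H = range V"
    and le_iff: "V \<phi> \<sqsubseteq> V \<psi> \<longleftrightarrow> \<phi> \<^bold>\<longrightarrow> \<psi> \<in> \<Gamma>"
begin

lemma greatest_conj: "greatest H (V (\<phi> \<^bold>\<and> \<psi>)) (Lower H {V \<phi>, V \<psi>})"
  by (auto simp: greatest_def Lower_def carrier all_conj_distrib le_iff intro: axioms impl_conj)

lemma least_disj: "least H (V (\<phi> \<^bold>\<or> \<psi>)) (Upper H {V \<phi>, V \<psi>})"
  by (auto simp: least_def Upper_def carrier all_conj_distrib le_iff intro: axioms disj_impl)

lemma least_falsum: "least H (V \<^bold>\<bottom>) (carrier H)"
  by (auto simp: least_def carrier le_iff intro: axioms)

lemma greatest_verum: "\<phi> \<in> \<Gamma> \<Longrightarrow> greatest H (V \<phi>) (carrier H)"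
  by (auto simp: greatest_def carrier le_iff intro: weaken)

lemma meet_V: "V \<phi> \<sqinter> V \<psi> = V (\<phi> \<^bold>\<and> \<psi>)"
  unfolding meet_def inf_def
  using greatest_conj greatest_unique by (intro some_equality) blast+

lemma join_V: "V \<phi> \<squnion> V \<psi> = V (\<phi> \<^bold>\<or> \<psi>)"
  unfolding join_def sup_def
  using least_disj least_unique by (intro some_equality) blast+

lemma bottom_V: "\<bottom> = V \<^bold>\<bottom>"
  unfolding bottom_def
  using least_falsum least_unique by (intro some_equality) blast+

lemma top_V: "\<phi> \<in> \<Gamma> \<Longrightarrow> \<top> = V \<phi>"
  unfolding top_def
  using greatest_verum greatest_unique by (intro some_equality) blast+

lemma greatest_impl:
  "greatest H (V (\<phi> \<^bold>\<longrightarrow> \<psi>)) {x \<in> carrier H. V \<phi> \<sqinter> x \<sqsubseteq> V \<psi>}"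
proof -
  have "\<phi> \<^bold>\<and> (\<phi> \<^bold>\<longrightarrow> \<psi>) \<^bold>\<longrightarrow> \<psi> \<in> \<Gamma>" unfolding residuation by (rule axioms)
  then show ?thesis
    by (auto simp: greatest_def carrier meet_V le_iff residuation)
qed

lemma himp_V: "V \<phi> \<leadsto> V \<psi> = V (\<phi> \<^bold>\<longrightarrow> \<psi>)"
  unfolding himp_def
  using greatest_impl greatest_unique by (intro the_equality) blast+

lemma top_iff: "V \<phi> = \<top> \<longleftrightarrow> \<phi> \<in> \<Gamma>"
proof
  have verum: "\<^bold>\<bottom> \<^bold>\<longrightarrow> \<^bold>\<bottom> \<in> \<Gamma>" by (rule axioms)
  assume "V \<phi> = \<top>"
  then have "V (\<^bold>\<bottom> \<^bold>\<longrightarrow> \<^bold>\<bottom>) \<sqsubseteq> V \<phi>" using top_V[OF verum] carrier by auto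
  then show "\<phi> \<in> \<Gamma>" using verum le_iff mp by blast
qed (simp add: top_V)

lemma heyting_algebra: "heyting_algebra H"
proof unfold_locales
  fix a b assume "a \<in> carrier H" "b \<in> carrier H"
  then obtain \<phi> \<psi> where "a = V \<phi>" "b = V \<psi>" using carrier by auto
  then show "\<exists>s. least H s (Upper H {a, b})" "\<exists>s. greatest H s (Lower H {a, b})"
    "\<exists>c. greatest H c {x \<in> carrier H. a \<sqinter> x \<sqsubseteq> b}"
    using least_disj greatest_conj greatest_impl by blast+
next
  show "\<exists>b. least H b (carrier H)" "\<exists>t. greatest H t (carrier H)"
    using least_falsum greatest_verum axioms(1) by blast+
qed

lemma eval_V: "eval H (\<lambda>p. V (\<sigma> p)) \<phi> = V (subst \<sigma> \<phi>)"
  by (induction \<phi>) (simp_all add: meet_V join_V bottom_V himp_V)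

text \<open>Since \<open>V\<close> is onto, the valuations of the algebra are exactly the substitutions followed by \<open>V\<close>.\<close>

lemma logic_of_eq: "logic_of H = {\<phi> :: 'w form. \<forall>\<sigma>. subst \<sigma> \<phi> \<in> \<Gamma>}"
proof -
  have "(\<forall>v. range v \<subseteq> carrier H \<longrightarrow> eval H v \<phi> = \<top>) \<longleftrightarrow> (\<forall>\<sigma>. subst \<sigma> \<phi> \<in> \<Gamma>)" for \<phi> :: "'w form"
  proof
    assume *: "\<forall>v. range v \<subseteq> carrier H \<longrightarrow> eval H v \<phi> = \<top>"
    show "\<forall>\<sigma>. subst \<sigma> \<phi> \<in> \<Gamma>"
    proof
      fix \<sigma> :: "'w \<Rightarrow> 'v form"
      have "range (\<lambda>p. V (\<sigma> p)) \<subseteq> carrier H" using carrier by auto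
      then show "subst \<sigma> \<phi> \<in> \<Gamma>" using * by (metis eval_V top_iff)
    qed
  next
    assume *: "\<forall>\<sigma>. subst \<sigma> \<phi> \<in> \<Gamma>"
    show "\<forall>v. range v \<subseteq> carrier H \<longrightarrow> eval H v \<phi> = \<top>"
    proof (intro allI impI)
      fix v :: "'w \<Rightarrow> 'a" assume "range v \<subseteq> carrier H"
      then have "\<forall>p. \<exists>\<psi>. v p = V \<psi>" using carrier by blast
      then obtain \<sigma> where "v = (\<lambda>p. V (\<sigma> p))" by metis
      then show "eval H v \<phi> = \<top>" using * by (simp add: eval_V top_iff)
    qed
  qed
  then show ?thesis by (simp add: logic_of_def)
qed

end

instance form :: (countable) countable
  by countable_datatype

text \<open>There are only countably many formulas, so an injection of the natural numbers into \<open>'a\<close> provides a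
  code for a chosen representative of each class.\<close>

lemma lindenbaum_algebra_in_infinite_type:
  fixes \<Gamma> :: "'v::countable form set"
  assumes "deductive_theory \<Gamma>" "infinite (UNIV :: 'a set)"
  obtains H :: "'a gorder" and V where "lindenbaum_algebra H \<Gamma> V"
proof -
  interpret deductive_theory \<Gamma> by fact
  obtain e :: "nat \<Rightarrow> 'a" where e: "inj e"
    using assms(2) infinite_countable_subset by blast
  define equiv where "equiv \<phi> \<psi> \<longleftrightarrow> \<phi> \<^bold>\<longrightarrow> \<psi> \<in> \<Gamma> \<and> \<psi> \<^bold>\<longrightarrow> \<phi> \<in> \<Gamma>" for \<phi> \<psi>
  define V where "V \<phi> = e (to_nat (Eps (equiv \<phi>)))" for \<phi>
  have V_iff: "V \<phi> = V \<psi> \<longleftrightarrow> equiv \<phi> \<psi>" for \<phi> \<psi>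
  proof
    have "equiv \<chi> (Eps (equiv \<chi>))" for \<chi>
      by (rule someI[of _ \<chi>]) (simp add: equiv_def axioms)
    moreover assume "V \<phi> = V \<psi>"
    then have "Eps (equiv \<phi>) = Eps (equiv \<psi>)" using e by (simp add: V_def inj_eq)
    ultimately have "equiv \<phi> (Eps (equiv \<phi>))" "equiv \<psi> (Eps (equiv \<phi>))" by metis+
    then show "equiv \<phi> \<psi>" unfolding equiv_def using impl_trans by blast
  next
    assume "equiv \<phi> \<psi>"
    then have "equiv \<phi> \<chi> \<longleftrightarrow> equiv \<psi> \<chi>" for \<chi>
      unfolding equiv_def using impl_trans by blast
    then have "equiv \<phi> = equiv \<psi>" by blast
    then show "V \<phi> = V \<psi>" by (simp add: V_def)
  qed
  define H :: "'a gorder" where "H = \<lparr>carrier = range V, eq = (=),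
    le = \<lambda>x y. \<exists>\<phi> \<psi>. x = V \<phi> \<and> y = V \<psi> \<and> \<phi> \<^bold>\<longrightarrow> \<psi> \<in> \<Gamma>\<rparr>"
  have le: "V \<phi> \<sqsubseteq>\<^bsub>H\<^esub> V \<psi> \<longleftrightarrow> \<phi> \<^bold>\<longrightarrow> \<psi> \<in> \<Gamma>" for \<phi> \<psi>
  proof
    assume "V \<phi> \<sqsubseteq>\<^bsub>H\<^esub> V \<psi>"
    then obtain \<phi>' \<psi>' where "equiv \<phi> \<phi>'" "equiv \<psi> \<psi>'" "\<phi>' \<^bold>\<longrightarrow> \<psi>' \<in> \<Gamma>"
      by (auto simp: H_def V_iff)
    then show "\<phi> \<^bold>\<longrightarrow> \<psi> \<in> \<Gamma>" unfolding equiv_def using impl_trans by blast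
  qed (auto simp: H_def)
  have H: "carrier H = range V" "eq H = (=)" by (simp_all add: H_def)
  have "lindenbaum_algebra H \<Gamma> V"
    proof unfold_locales
    fix x y z assume "x \<in> carrier H" "y \<in> carrier H" "z \<in> carrier H"
    then obtain \<phi> \<psi> \<chi> where "x = V \<phi>" "y = V \<psi>" "z = V \<chi>" by (auto simp: H)
    moreover assume "x \<sqsubseteq>\<^bsub>H\<^esub> y" "y \<sqsubseteq>\<^bsub>H\<^esub> z"
    ultimately show "x \<sqsubseteq>\<^bsub>H\<^esub> z" by (simp add: le impl_trans[of \<phi> \<psi> \<chi>])
  qed (auto simp: le H V_iff equiv_def axioms)
  then show thesis by (rule that)
qed

section \<open>Well-connected algebras and Hallden completeness\<close>

lemma himp_greatest:
  fixes H :: "'a gorder" (structure)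
  assumes "heyting_algebra H" "a \<in> carrier H" "b \<in> carrier H"
  shows "greatest H (a \<leadsto> b) {x \<in> carrier H. a \<sqinter> x \<sqsubseteq> b}"
proof -
  interpret heyting_algebra H by fact
  have "\<exists>!c. greatest H c {x \<in> carrier H. a \<sqinter> x \<sqsubseteq> b}"
    using relative_pseudocomplement_exists greatest_unique assms by blast
  then show ?thesis unfolding himp_def by (rule theI')
qed

lemma eval_closed:
  assumes "heyting_algebra H" "range v \<subseteq> carrier H"
  shows "eval H v \<phi> \<in> carrier H"
proof -
  interpret heyting_algebra H by fact
  show ?thesis
  proof (induction \<phi>)
    case (Impl \<phi> \<psi>)
    then show ?case using himp_greatest[OF assms(1)] unfolding greatest_def by simp
  qed (use assms(2) in auto)
qed

lemma eval_cong: "(\<And>p. p \<in> letters \<phi> \<Longrightarrow> v p = w p) \<Longrightarrow> eval H v \<phi> = eval H w \<phi>"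
  by (induction \<phi>) auto

text \<open>As the letters are disjoint, a valuation refuting \<open>\<phi>\<close> and one refuting \<open>\<psi>\<close> can be merged.\<close>

lemma hallden_complete_logic_of:
  assumes "well_connected_algebra H"
  shows "hallden_complete (logic_of H)"
  unfolding hallden_complete_def
proof (intro allI impI, rule ccontr)
  fix \<phi> \<psi> :: "'v form"
  interpret heyting_algebra H using assms by (simp add: well_connected_algebra_def)
  assume disj: "\<phi> \<^bold>\<or> \<psi> \<in> logic_of H" and disjoint: "letters \<phi> \<inter> letters \<psi> = {}"
  assume "\<not> (\<phi> \<in> logic_of H \<or> \<psi> \<in> logic_of H)"
  then obtain v w where vw: "range v \<subseteq> carrier H" "range w \<subseteq> carrier H"
    "eval H v \<phi> \<noteq> \<top>\<^bsub>H\<^esub>" "eval H w \<psi> \<noteq> \<top>\<^bsub>H\<^esub>"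
    by (auto simp: logic_of_def)
  define u where "u p = (if p \<in> letters \<phi> then v p else w p)" for p
  have u: "range u \<subseteq> carrier H" using vw(1,2) by (auto simp: u_def)
  have "eval H u \<phi> = eval H v \<phi>" "eval H u \<psi> = eval H w \<psi>"
    using disjoint by (auto simp: u_def intro!: eval_cong)
  moreover have "eval H u \<phi> \<squnion>\<^bsub>H\<^esub> eval H u \<psi> = \<top>\<^bsub>H\<^esub>"
    using disj u by (auto simp: logic_of_def)
  ultimately show False
    using assms vw eval_closed[OF heyting_algebra_axioms u] by (metis well_connected_algebra_def)
qed

lemma well_connected_subalgebra_Up:
  assumes "heyting_subalgebra S (Up F)"
    and root: "r \<in> carrier F" "\<And>w. w \<in> carrier F \<Longrightarrow> r \<sqsubseteq>\<^bsub>F\<^esub> w"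
  shows "well_connected_algebra ((Up F)\<lparr>carrier := S\<rparr>)"
proof -
  have S: "upset F A" if "A \<in> S" for A
    using assms(1) that by (auto simp: heyting_subalgebra_def Up_sel)
  have "A = carrier F \<or> B = carrier F"
    if "A \<in> S" "B \<in> S" "A \<union> B = carrier F" for A B
    using S[OF that(1)] S[OF that(2)] that(3) root unfolding upset_def by blast
  then show ?thesis
    unfolding well_connected_algebra_def
    using heyting_algebra_subalgebra[OF assms(1)] S
    by (simp add: top_subalgebra[OF assms(1)] join_subalgebra[OF assms(1)] top_Up join_Up)
qed

section \<open>A prime theory that determines a Hallden complete logic\<close>

text \<open>One classical valuation under which all theorems of \<open>CPC\<close> are true shows that \<open>CPC\<close> is consistent.\<close>

primrec true_under_all_false :: "'v form \<Rightarrow> bool" where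
  "true_under_all_false (Letter p) \<longleftrightarrow> False"
| "true_under_all_false \<^bold>\<bottom> \<longleftrightarrow> False"
| "true_under_all_false (\<phi> \<^bold>\<and> \<psi>) \<longleftrightarrow> true_under_all_false \<phi> \<and> true_under_all_false \<psi>"
| "true_under_all_false (\<phi> \<^bold>\<or> \<psi>) \<longleftrightarrow> true_under_all_false \<phi> \<or> true_under_all_false \<psi>"
| "true_under_all_false (\<phi> \<^bold>\<longrightarrow> \<psi>) \<longleftrightarrow> (true_under_all_false \<phi> \<longrightarrow> true_under_all_false \<psi>)"

lemma falsum_notin_CPC: "\<^bold>\<bottom> \<notin> CPC"
proof -
  have "true_under_all_false \<phi>" if "\<phi> \<in> CPC" for \<phi> :: "'v form"
    using that unfolding CPC_def by induction auto
  then show ?thesis by fastforce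
qed

lemma intermediate_logic_deductive_theory:
  assumes "intermediate_logic L"
  shows "deductive_theory L"
proof
  have IPC: "IPC \<subseteq> L" and MP: "\<And>\<phi> \<psi>. \<phi> \<^bold>\<longrightarrow> \<psi> \<in> L \<Longrightarrow> \<phi> \<in> L \<Longrightarrow> \<psi> \<in> L"
    using assms by (auto simp: intermediate_logic_def)
  show "derivable L \<subseteq> L"
  proof
    fix \<phi> assume "\<phi> \<in> derivable L"
    then show "\<phi> \<in> L"
    proof induction
      case (MP \<phi> \<psi>)
      then show ?case using \<open>\<And>\<phi> \<psi>. \<phi> \<^bold>\<longrightarrow> \<psi> \<in> L \<Longrightarrow> \<phi> \<in> L \<Longrightarrow> \<psi> \<in> L\<close> by blast
    qed (assumption | rule subsetD[OF IPC], unfold IPC_def, rule derivable_axioms)+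
  qed
qed

lemma letters_subst: "letters (subst \<sigma> \<phi>) = (\<Union>p\<in>letters \<phi>. letters (\<sigma> p))"
  by (induction \<phi>) auto

lemma subst_subst_inverse:
  "(\<And>p. subst \<tau> (\<sigma> p) = Letter p) \<Longrightarrow> subst \<tau> (subst \<sigma> \<phi>) = \<phi>"
  by (induction \<phi>) auto

text \<open>The formulas \<open>copy n\<close> are renamings of all formulas with pairwise disjoint sets of letters, and
  \<open>bound n\<close> is the disjunction of the first \<open>n\<close> of them, leaving out those that come from theorems of
  \<open>L\<close>. By Hallden completeness no \<open>bound n\<close> is in \<open>L\<close>. The bounds form a chain, hence a directed set that
  some prime theory avoids, and this theory omits an instance of each non-theorem.\<close>

lemma hallden_complete_prime_theory:
  fixes L :: "nat form set"
  assumes L: "intermediate_logic L" and "hallden_complete L"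
  obtains \<Gamma> :: "nat form set" where "prime_theory \<Gamma>" "L = {\<phi>. \<forall>\<sigma>. subst \<sigma> \<phi> \<in> \<Gamma>}"
proof -
  interpret deductive_theory L by (rule intermediate_logic_deductive_theory[OF L])
  have subst: "subst \<sigma> \<phi> \<in> L" if "\<phi> \<in> L" for \<sigma> \<phi>
    using L that by (auto simp: intermediate_logic_def)
  define copy :: "nat \<Rightarrow> nat form" where
    "copy n = subst (\<lambda>p. Letter (prod_encode (n, p))) (from_nat n)" for n
  define bound where
    "bound = rec_nat \<^bold>\<bottom> (\<lambda>n \<delta>. if from_nat n \<in> L then \<delta> else \<delta> \<^bold>\<or> copy n)"
  have bound_simps: "bound 0 = \<^bold>\<bottom>"
    "bound (Suc n) = (if from_nat n \<in> L then bound n else bound n \<^bold>\<or> copy n)" for n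
    by (simp_all add: bound_def)
  have copy: "from_nat n \<in> L" if "copy n \<in> L" for n
  proof -
    have "subst (\<lambda>q. Letter (snd (prod_decode q))) (copy n) = from_nat n"
      unfolding copy_def by (rule subst_subst_inverse) simp
    then show ?thesis using subst[OF that] by metis
  qed
  have letters_copy: "fst (prod_decode q) = n" if "q \<in> letters (copy n)" for q n
    using that by (auto simp: copy_def letters_subst)
  have letters_bound: "fst (prod_decode q) < n" if "q \<in> letters (bound n)" for q n
    using that by (induction n) (auto simp: bound_simps letters_copy less_Suc_eq split: if_splits)
  \<comment> \<open>\<open>bound n\<close> uses only letters tagged with numbers below \<open>n\<close>, so Hallden completeness applies
    to \<open>bound n \<^bold>\<or> copy n\<close>.\<close>
  have "bound n \<notin> L" for n
  proof (induction n)
    case 0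
    then show ?case using L falsum_notin_CPC by (auto simp: bound_simps intermediate_logic_def)
  next
    case (Suc n)
    have "letters (bound n) \<inter> letters (copy n) = {}"
      using letters_bound letters_copy by fastforce
    then show ?case
      using Suc copy \<open>hallden_complete L\<close> by (auto simp: bound_simps hallden_complete_def)
  qed
  moreover have mono: "bound m \<^bold>\<longrightarrow> bound n \<in> L" if "m \<le> n" for m n
    using that
  proof (induction rule: dec_induct)
    case (step n)
    then show ?case by (auto simp: bound_simps intro: impl_trans axioms)
  qed (rule axioms)
  then have "\<exists>\<zeta>\<in>range bound. \<delta> \<^bold>\<longrightarrow> \<zeta> \<in> L \<and> \<epsilon> \<^bold>\<longrightarrow> \<zeta> \<in> L"
    if "\<delta> \<in> range bound" "\<epsilon> \<in> range bound" for \<delta> \<epsilon>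
    using that by (metis imageE rangeI max.cobounded1 max.cobounded2)
  ultimately obtain \<Gamma> where \<Gamma>: "prime_theory \<Gamma>" "L \<subseteq> \<Gamma>" "\<Gamma> \<inter> range bound = {}"
    using prime_theory_avoiding[OF deductive_theory_axioms, of "range bound"] by blast
  interpret \<Gamma>: prime_theory \<Gamma> by fact
  have "\<exists>\<sigma>. subst \<sigma> \<phi> \<notin> \<Gamma>" if "\<phi> \<notin> L" for \<phi>
  proof -
    have "bound (Suc (to_nat \<phi>)) \<notin> \<Gamma>" using \<Gamma>(3) by blast
    then have "copy (to_nat \<phi>) \<notin> \<Gamma>"
      using that by (auto simp: bound_simps \<Gamma>.disj_iff)
    then show ?thesis by (auto simp: copy_def)
  qed
  then have "L = {\<phi>. \<forall>\<sigma>. subst \<sigma> \<phi> \<in> \<Gamma>}" using subst \<Gamma>(2) by blast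
  with \<Gamma>(1) show thesis by (rule that)
qed

section \<open>Frames labelled by prime theories\<close>

text \<open>The axioms say that \<open>label\<close> is a map into the canonical Kripke model of prime theories under which
  membership of an implication agrees with its truth in the frame \<open>F\<close>, as is the case for p-morphisms.\<close>

locale labelled_frame = partial_order F
  for F :: "'w gorder" (structure) +
  fixes label :: "'w \<Rightarrow> 'v form set" and r :: 'w
  assumes root: "r \<in> carrier F" "w \<in> carrier F \<Longrightarrow> r \<sqsubseteq> w"
    and prime: "w \<in> carrier F \<Longrightarrow> prime_theory (label w)"
    and mono: "w \<in> carrier F \<Longrightarrow> u \<in> carrier F \<Longrightarrow> w \<sqsubseteq> u \<Longrightarrow> label w \<subseteq> label u"
    and witness: "w \<in> carrier F \<Longrightarrow> \<phi> \<^bold>\<longrightarrow> \<psi> \<notin> label w \<Longrightarrow>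
      \<exists>u\<in>carrier F. w \<sqsubseteq> u \<and> \<phi> \<in> label u \<and> \<psi> \<notin> label u"
begin

definition truth_set :: "'v form \<Rightarrow> 'w set" where
  "truth_set \<phi> = {w \<in> carrier F. \<phi> \<in> label w}"

lemma theory_label: "w \<in> carrier F \<Longrightarrow> deductive_theory (label w)"
  using prime prime_theory.axioms(1) by blast

lemma upset_truth_set: "upset F (truth_set \<phi>)"
  using mono by (auto simp: upset_def truth_set_def)

lemma impl_iff:
  assumes "w \<in> carrier F"
  shows "\<phi> \<^bold>\<longrightarrow> \<psi> \<in> label w \<longleftrightarrow>
    (\<forall>u\<in>carrier F. w \<sqsubseteq> u \<longrightarrow> \<phi> \<in> label u \<longrightarrow> \<psi> \<in> label u)"
proof
  assume "\<phi> \<^bold>\<longrightarrow> \<psi> \<in> label w"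
  then show "\<forall>u\<in>carrier F. w \<sqsubseteq> u \<longrightarrow> \<phi> \<in> label u \<longrightarrow> \<psi> \<in> label u"
    using mono[OF assms] deductive_theory.mp[OF theory_label] by blast
next
  assume "\<forall>u\<in>carrier F. w \<sqsubseteq> u \<longrightarrow> \<phi> \<in> label u \<longrightarrow> \<psi> \<in> label u"
  then show "\<phi> \<^bold>\<longrightarrow> \<psi> \<in> label w" using witness[OF assms] by blast
qed

lemma heyting_subalgebra_truth_sets: "heyting_subalgebra (range truth_set) (Up F)"
proof -
  have ops: "truth_set \<phi> \<inter> truth_set \<psi> = truth_set (\<phi> \<^bold>\<and> \<psi>)"
    "truth_set \<phi> \<union> truth_set \<psi> = truth_set (\<phi> \<^bold>\<or> \<psi>)"
    "truth_set \<phi> \<leadsto>\<^bsub>Up F\<^esub> truth_set \<psi> = truth_set (\<phi> \<^bold>\<longrightarrow> \<psi>)" for \<phi> \<psi>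
    using himp_Up[OF partial_order_axioms upset_truth_set upset_truth_set, of \<phi> \<psi>]
    by (auto simp: truth_set_def impl_iff deductive_theory.conj_iff[OF theory_label]
        prime_theory.disj_iff[OF prime])
  have "{} = truth_set \<^bold>\<bottom>" "carrier F = truth_set (\<^bold>\<bottom> \<^bold>\<longrightarrow> \<^bold>\<bottom>)"
    by (auto simp: truth_set_def prime_theory.consistent[OF prime]
        deductive_theory.axioms(1)[OF theory_label])
  then show ?thesis
    using heyting_algebra_Up[OF partial_order_axioms]
    by (auto simp: heyting_subalgebra_def meet_Up join_Up top_Up bottom_Up upset_truth_set ops
        Up_sel)
qed

lemma truth_set_subset_iff: "truth_set \<phi> \<subseteq> truth_set \<psi> \<longleftrightarrow> \<phi> \<^bold>\<longrightarrow> \<psi> \<in> label r"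
  using root by (auto simp: impl_iff truth_set_def)

lemma logic_of_truth_sets:
  "logic_of ((Up F)\<lparr>carrier := range truth_set\<rparr>) = {\<phi>. \<forall>\<sigma>. subst \<sigma> \<phi> \<in> label r}"
proof -
  interpret U: partial_order "(Up F)\<lparr>carrier := range truth_set\<rparr>"
    by (rule partial_order_subalgebra[OF heyting_subalgebra_truth_sets])
  interpret R: deductive_theory "label r" by (rule theory_label[OF root(1)])
  interpret lindenbaum_algebra "(Up F)\<lparr>carrier := range truth_set\<rparr>" "label r" truth_set
    by unfold_locales (simp_all add: Up_sel truth_set_subset_iff)
  show ?thesis by (rule logic_of_eq)
qed

end

section \<open>Labelling the binary trees\<close>

text \<open>The first case makes the step to a right child harmless when the scheduled implication is already in
  the theory.\<close>

definition refuter :: "'v form set \<Rightarrow> 'v form \<times> 'v form \<Rightarrow> 'v form set" where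
  "refuter \<Gamma> = (\<lambda>(\<phi>, \<psi>). if \<phi> \<^bold>\<longrightarrow> \<psi> \<in> \<Gamma> then \<Gamma>
     else SOME P. prime_theory P \<and> \<Gamma> \<subseteq> P \<and> \<phi> \<in> P \<and> \<psi> \<notin> P)"

lemma refuter:
  assumes "prime_theory \<Gamma>"
  shows "prime_theory (refuter \<Gamma> (\<phi>, \<psi>))" "\<Gamma> \<subseteq> refuter \<Gamma> (\<phi>, \<psi>)"
    "\<phi> \<^bold>\<longrightarrow> \<psi> \<notin> \<Gamma> \<Longrightarrow> \<phi> \<in> refuter \<Gamma> (\<phi>, \<psi>) \<and> \<psi> \<notin> refuter \<Gamma> (\<phi>, \<psi>)"
proof -
  let ?good = "\<lambda>P. prime_theory P \<and> \<Gamma> \<subseteq> P \<and> \<phi> \<in> P \<and> \<psi> \<notin> P"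
  interpret prime_theory \<Gamma> by fact
  have "?good (SOME P. ?good P)" if new: "\<phi> \<^bold>\<longrightarrow> \<psi> \<notin> \<Gamma>"
  proof -
    obtain P where "?good P" using prime_extension_refuting_impl[OF new] by blast
    then show ?thesis by (rule someI)
  qed
  then show "prime_theory (refuter \<Gamma> (\<phi>, \<psi>))" "\<Gamma> \<subseteq> refuter \<Gamma> (\<phi>, \<psi>)"
    "\<phi> \<^bold>\<longrightarrow> \<psi> \<notin> \<Gamma> \<Longrightarrow> \<phi> \<in> refuter \<Gamma> (\<phi>, \<psi>) \<and> \<psi> \<notin> refuter \<Gamma> (\<phi>, \<psi>)"
    using assms by (auto simp: refuter_def)
qed

text \<open>A list of all elements of a countable type in which each of them occurs at arbitrarily late positions.\<close>

definition task :: "nat \<Rightarrow> 'a::countable" where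
  "task n = from_nat (fst (prod_decode n))"

lemma task_recurs: "\<exists>n\<ge>m. task n = x"
proof -
  have "task (prod_encode (to_nat x, m)) = x" by (simp add: task_def)
  then show ?thesis using le_prod_encode_2 by blast
qed

text \<open>Paths are built by appending at the end, so the recursion runs over the reversed path. \<open>False\<close> is a
  step to the left and \<open>True\<close> a step to the right.\<close>

primrec rev_label :: "'v::countable form set \<Rightarrow> bool list \<Rightarrow> 'v form set" where
  "rev_label \<Gamma> [] = \<Gamma>"
| "rev_label \<Gamma> (b # s) =
     (if b then refuter (rev_label \<Gamma> s) (task (length s)) else rev_label \<Gamma> s)"

definition label :: "'v::countable form set \<Rightarrow> bool list \<Rightarrow> 'v form set" where
  "label \<Gamma> s = rev_label \<Gamma> (rev s)"

lemma label_simps: "label \<Gamma> [] = \<Gamma>" "label \<Gamma> (s @ [b]) =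
    (if b then refuter (label \<Gamma> s) (task (length s)) else label \<Gamma> s)"
  by (simp_all add: label_def)

context
  fixes \<Gamma> :: "'v::countable form set"
  assumes \<Gamma>: "prime_theory \<Gamma>"
begin

lemma prime_theory_label: "prime_theory (label \<Gamma> s)"
proof (induction s rule: rev_induct)
  case (snoc b s)
  then show ?case
    using refuter(1) by (cases "task (length s) :: 'v form \<times> 'v form") (auto simp: label_simps)
qed (simp add: label_simps \<Gamma>)

lemma label_mono: "prefix s t \<Longrightarrow> label \<Gamma> s \<subseteq> label \<Gamma> t"
proof (induction t rule: rev_induct)
  case (snoc b t)
  have "label \<Gamma> t \<subseteq> label \<Gamma> (t @ [b])"
    using refuter(2)[OF prime_theory_label]
    by (cases "task (length t) :: 'v form \<times> 'v form") (simp add: label_simps)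
  then show ?case using snoc by (auto simp: prefix_snoc)
qed simp

lemma label_replicate_False: "label \<Gamma> (s @ replicate n False) = label \<Gamma> s"
  by (induction n) (simp_all add: label_simps replicate_append_same[symmetric] flip: append_assoc)

text \<open>Move to the left, which keeps the theory, until the depth is one at which the implication is
  scheduled; then move to the right.\<close>

lemma label_witness:
  assumes "\<phi> \<^bold>\<longrightarrow> \<psi> \<notin> label \<Gamma> s"
  shows "\<exists>t. prefix s t \<and> \<phi> \<in> label \<Gamma> t \<and> \<psi> \<notin> label \<Gamma> t"
proof -
  obtain n where n: "n \<ge> length s" "task n = (\<phi>, \<psi>)" using task_recurs by blast
  define t where "t = s @ replicate (n - length s) False"
  have t: "length t = n" "label \<Gamma> t = label \<Gamma> s"
    using n(1) by (simp_all add: t_def label_replicate_False)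
  have "\<phi> \<in> label \<Gamma> (t @ [True])" "\<psi> \<notin> label \<Gamma> (t @ [True])"
    using refuter(3)[OF prime_theory_label assms] by (simp_all add: label_simps t n(2))
  moreover have "prefix s (t @ [True])" by (simp add: t_def)
  ultimately show ?thesis by blast
qed

lemma labelled_frame_T2: "labelled_frame T2 (label \<Gamma>) []"
  by (intro labelled_frame.intro labelled_frame_axioms.intro partial_order_T2)
    (simp_all add: T2_def prime_theory_label label_mono label_witness)

lemma prefix_map_upt_le: "m \<le> n \<Longrightarrow> prefix (map f [0..<m]) (map f [0..<n])"
  using upt_add_eq_append[of 0 m "n - m"] by simp

text \<open>The theory chosen for an infinite branch has to decide every formula, because no point above the branch
  could refute a missing implication. A maximal theory that avoids \<open>\<^bold>\<bottom>\<close> does so.\<close>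

lemma branch_theory_exists:
  "\<exists>M. deductive_theory M \<and> \<^bold>\<bottom> \<notin> M \<and> (\<forall>n. label \<Gamma> (map f [0..<n]) \<subseteq> M) \<and>
     (\<forall>\<phi>. \<phi> \<notin> M \<longrightarrow> \<phi> \<^bold>\<longrightarrow> \<^bold>\<bottom> \<in> M)"
proof -
  let ?U = "\<Union>n. label \<Gamma> (map f [0..<n])"
  have union: "deductive_theory ?U"
  proof (rule deductive_theory_Union_chain)
    fix S T assume "S \<in> range (\<lambda>n. label \<Gamma> (map f [0..<n]))"
      "T \<in> range (\<lambda>n. label \<Gamma> (map f [0..<n]))"
    then obtain m n where "S = label \<Gamma> (map f [0..<m])" "T = label \<Gamma> (map f [0..<n])"
      by blast
    then show "S \<subseteq> T \<or> T \<subseteq> S"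
      using label_mono[OF prefix_map_upt_le, of m n f] label_mono[OF prefix_map_upt_le, of n m f]
        nat_le_linear[of m n] by auto
  next
    fix T assume "T \<in> range (\<lambda>n. label \<Gamma> (map f [0..<n]))"
    then show "deductive_theory T" using prime_theory.axioms(1)[OF prime_theory_label] by blast
  qed simp
  have avoid: "?U \<inter> {\<^bold>\<bottom>} = {}"
    using prime_theory.consistent[OF prime_theory_label] by simp
  obtain M where M: "deductive_theory M" "?U \<subseteq> M" "M \<inter> {\<^bold>\<bottom>} = {}"
    "\<And>\<phi>. \<phi> \<notin> M \<Longrightarrow> \<exists>\<delta>\<in>{\<^bold>\<bottom>}. \<phi> \<^bold>\<longrightarrow> \<delta> \<in> M"
    using maximal_theory_avoiding[OF union avoid] by metis
  then show ?thesis by (intro exI[of _ M]) (simp add: UN_subset_iff)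
qed

definition branch_theory :: "(nat \<Rightarrow> bool) \<Rightarrow> 'v form set" where
  "branch_theory f = (SOME M. deductive_theory M \<and> \<^bold>\<bottom> \<notin> M \<and>
     (\<forall>n. label \<Gamma> (map f [0..<n]) \<subseteq> M) \<and> (\<forall>\<phi>. \<phi> \<notin> M \<longrightarrow> \<phi> \<^bold>\<longrightarrow> \<^bold>\<bottom> \<in> M))"

lemma branch_theory:
  "deductive_theory (branch_theory f)" "\<^bold>\<bottom> \<notin> branch_theory f"
  "label \<Gamma> (map f [0..<n]) \<subseteq> branch_theory f"
  "\<phi> \<notin> branch_theory f \<Longrightarrow> \<phi> \<^bold>\<longrightarrow> \<^bold>\<bottom> \<in> branch_theory f"
  using someI_ex[OF branch_theory_exists[of f]] unfolding branch_theory_def[symmetric] by simp_all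

lemma prime_branch_theory: "prime_theory (branch_theory f)"
proof -
  interpret deductive_theory "branch_theory f" by (rule branch_theory)
  show ?thesis
  proof
    fix \<phi> \<psi> assume "\<phi> \<^bold>\<or> \<psi> \<in> branch_theory f"
    then show "\<phi> \<in> branch_theory f \<or> \<psi> \<in> branch_theory f"
      using branch_theory(2) branch_theory(4)[of \<phi> f] branch_theory(4)[of \<psi> f]
        mp[OF disj_impl[of \<phi> "\<^bold>\<bottom>" \<psi>]] by blast
  qed (rule branch_theory)
qed

text \<open>Since the branch theory is complete, a missing implication is refuted at the branch itself.\<close>

lemma branch_theory_witness:
  assumes "\<phi> \<^bold>\<longrightarrow> \<psi> \<notin> branch_theory f"
  shows "\<phi> \<in> branch_theory f \<and> \<psi> \<notin> branch_theory f"
proof -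
  interpret deductive_theory "branch_theory f" by (rule branch_theory)
  show ?thesis using assms branch_theory(4)[of \<phi> f] weaken[of \<psi> \<phi>] impl_trans[OF _ axioms(8)] by blast
qed

definition branch_label :: "bseq \<Rightarrow> 'v form set" where
  "branch_label x = (case x of Fin s \<Rightarrow> label \<Gamma> s | Inf f \<Rightarrow> branch_theory f)"

lemma branch_label_Nil: "branch_label (Fin []) = \<Gamma>"
  by (simp add: branch_label_def label_simps)

lemma labelled_frame_L2: "labelled_frame L2 branch_label (Fin [])"
proof -
  have mono: "branch_label x \<subseteq> branch_label y" if "initial_segment x y" for x y
  proof (cases x; cases y)
    fix s f assume "x = Fin s" "y = Inf f"
    then show ?thesis using that branch_theory(3)[of f "length s"] by (simp add: branch_label_def)
  qed (use that label_mono in \<open>auto simp: branch_label_def\<close>)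
  have witness: "\<exists>y. initial_segment x y \<and> \<phi> \<in> branch_label y \<and> \<psi> \<notin> branch_label y"
    if refuted: "\<phi> \<^bold>\<longrightarrow> \<psi> \<notin> branch_label x" for x \<phi> \<psi>
  proof (cases x)
    case (Fin s)
    then obtain t where "prefix s t" "\<phi> \<in> label \<Gamma> t" "\<psi> \<notin> label \<Gamma> t"
      using refuted Fin label_witness[of \<phi> \<psi> s] by (auto simp: branch_label_def)
    then show ?thesis using Fin by (intro exI[of _ "Fin t"]) (simp add: branch_label_def)
  next
    case (Inf f)
    then show ?thesis
      using refuted branch_theory_witness[of \<phi> \<psi> f] Inf
      by (intro exI[of _ x]) (simp add: branch_label_def)
  qed
  show ?thesis
  proof (intro labelled_frame.intro labelled_frame_axioms.intro partial_order_L2)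
    fix x show "Fin [] \<sqsubseteq>\<^bsub>L2\<^esub> x" by (cases x) (simp_all add: L2_def)
    show "prime_theory (branch_label x)"
      by (cases x) (simp_all add: branch_label_def prime_theory_label prime_branch_theory)
  qed (simp_all add: L2_def mono witness)
qed

end

section \<open>The equivalences\<close>

text \<open>The labelling is demanded for every prime theory because the one that belongs to \<open>L\<close> is produced
  only in the proof.\<close>

lemma hallden_complete_iff_rooted_frame:
  fixes F :: "'w gorder" and L :: "nat form set"
  assumes "intermediate_logic L"
    and label: "\<And>\<Gamma> :: nat form set. prime_theory \<Gamma> \<Longrightarrow> \<exists>l. labelled_frame F l r \<and> l r = \<Gamma>"
    and root: "r \<in> carrier F" "\<And>w. w \<in> carrier F \<Longrightarrow> r \<sqsubseteq>\<^bsub>F\<^esub> w"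
  shows "hallden_complete L \<longleftrightarrow>
    (\<exists>S. heyting_subalgebra S (Up F) \<and> L = logic_of ((Up F)\<lparr>carrier := S\<rparr>))"
proof
  assume "hallden_complete L"
  then obtain \<Gamma> :: "nat form set" where \<Gamma>: "prime_theory \<Gamma>" "L = {\<phi>. \<forall>\<sigma>. subst \<sigma> \<phi> \<in> \<Gamma>}"
    using hallden_complete_prime_theory[OF assms(1)] by blast
  then obtain l where l: "labelled_frame F l r" "l r = \<Gamma>" using label by blast
  show "\<exists>S. heyting_subalgebra S (Up F) \<and> L = logic_of ((Up F)\<lparr>carrier := S\<rparr>)"
    using labelled_frame.heyting_subalgebra_truth_sets[OF l(1)]
      labelled_frame.logic_of_truth_sets[OF l(1)] \<Gamma>(2) l(2) by blast
next
  assume "\<exists>S. heyting_subalgebra S (Up F) \<and> L = logic_of ((Up F)\<lparr>carrier := S\<rparr>)"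
  then show "hallden_complete L"
    using hallden_complete_logic_of[OF well_connected_subalgebra_Up[OF _ root]] by blast
qed

lemma well_connected_logic_iff_hallden_complete:
  fixes L :: "nat form set"
  assumes "intermediate_logic L" and inf: "infinite (UNIV :: 'a set)"
  shows "well_connected_logic TYPE('a) L \<longleftrightarrow> hallden_complete L"
proof
  assume "well_connected_logic TYPE('a) L"
  then show "hallden_complete L"
    unfolding well_connected_logic_def using hallden_complete_logic_of by blast
next
  assume "hallden_complete L"
  then obtain \<Gamma> :: "nat form set" where \<Gamma>: "prime_theory \<Gamma>" "L = {\<phi>. \<forall>\<sigma>. subst \<sigma> \<phi> \<in> \<Gamma>}"
    using hallden_complete_prime_theory[OF assms(1)] by blast
  interpret prime_theory \<Gamma> by fact
  obtain H :: "'a gorder" and V where "lindenbaum_algebra H \<Gamma> V"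
    using lindenbaum_algebra_in_infinite_type[OF deductive_theory_axioms inf] by blast
  then interpret H: lindenbaum_algebra H \<Gamma> V .
  have "well_connected_algebra H"
    using H.heyting_algebra prime
    by (auto simp: well_connected_algebra_def H.carrier H.join_V H.top_iff)
  then show "well_connected_logic TYPE('a) L"
    using H.logic_of_eq \<Gamma>(2) unfolding well_connected_logic_def by blast
qed

theorem theorem10p2:
  fixes L :: "nat form set"
  assumes "intermediate_logic L"
    and "infinite (UNIV :: 'a set)"
  shows "(well_connected_logic TYPE('a) L \<longleftrightarrow> hallden_complete L) \<and>
    (hallden_complete L \<longleftrightarrow> (\<exists>\<U>. general_intuitionistic_frame T2 \<U> \<and> L = frame_logic T2 \<U>)) \<and>
    (hallden_complete L \<longleftrightarrow> (\<exists>\<U>. general_intuitionistic_frame L2 \<U> \<and> L = frame_logic L2 \<U>)) \<and>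
    (hallden_complete L \<longleftrightarrow> (\<exists>S. heyting_subalgebra S (Up T2) \<and> L = logic_of ((Up T2)\<lparr>carrier := S\<rparr>))) \<and>
    (hallden_complete L \<longleftrightarrow> (\<exists>S. heyting_subalgebra S (Up L2) \<and> L = logic_of ((Up L2)\<lparr>carrier := S\<rparr>)))"
proof -
  have T2: "hallden_complete L \<longleftrightarrow>
      (\<exists>S. heyting_subalgebra S (Up T2) \<and> L = logic_of ((Up T2)\<lparr>carrier := S\<rparr>))"
  proof (rule hallden_complete_iff_rooted_frame[OF assms(1)])
    fix \<Gamma> :: "nat form set" assume "prime_theory \<Gamma>"
    then show "\<exists>l. labelled_frame T2 l [] \<and> l [] = \<Gamma>"
      by (intro exI[of _ "label \<Gamma>"]) (simp add: labelled_frame_T2 label_simps)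
  qed (auto simp: T2_def)
  have L2: "hallden_complete L \<longleftrightarrow>
      (\<exists>S. heyting_subalgebra S (Up L2) \<and> L = logic_of ((Up L2)\<lparr>carrier := S\<rparr>))"
  proof (rule hallden_complete_iff_rooted_frame[OF assms(1)])
    fix \<Gamma> :: "nat form set" assume "prime_theory \<Gamma>"
    then show "\<exists>l. labelled_frame L2 l (Fin []) \<and> l (Fin []) = \<Gamma>"
      by (intro exI[of _ "branch_label \<Gamma>"]) (simp add: labelled_frame_L2 branch_label_Nil)
  next
    show "Fin [] \<sqsubseteq>\<^bsub>L2\<^esub> x" for x by (cases x) (simp_all add: L2_def)
  qed (simp add: L2_def)
  show ?thesis
    using well_connected_logic_iff_hallden_complete[OF assms] T2 L2
    by (simp add: general_intuitionistic_frame_def frame_logic_def partial_order_T2 partial_order_L2)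
qed

end
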